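(* Let $X,Y$ be two openly factorizable (Tychonoff) spaces. If the product $X\times Y$ is weakly Lindelöf, then (1) the product $X\times Y$ is openly factorizable; (2) each continuous map $f:X\times Y\to Z$ to a Tychonoff space $Z$ extends to a continuous map $\bar f:\upsilon X\times\upsilon Y\to\upsilon Z$.
   Context: All topological spaces are assumed to be Tychonoff. A space $X$ is openly factorizable if for each continuous map $f:X\to Y$ to a second countable space $Y$ there are a continuous open map $p:X\to Z$ onto a second countable space $Z$ and a continuous map $g:Z\to Y$ such that $f=g\circ p$. A space $X$ is weakly Lindelöf if each open cover $\mathcal U$ of $X$ contains a countable subcollection $\mathcal V\subset\mathcal U$ whose union is dense in $X$. A space is real complete if it is homeomorphic to a closed subspace of some power $\mathbb R^\kappa$ of the real line. The Hewitt completion $\upsilon X$ of a Tychonoff space $X$ is a real complete space containing $X$ as a dense subspace such that each continuous map from $X$ to a real complete space $Y$ extends to a continuous map $\upsilon X\to Y$. *)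

theory Defs
  imports "HOL-Analysis.Analysis"
begin

text \<open>
  Throughout, a space is a value of the library type \<open>'a topology\<close>, whose carrier
  \<open>topspace X\<close> need not be the whole type.  Definitions below that quantify over
  ``all spaces'' (or all cardinals) have to do so over one fixed HOL type.  In each case the type is
  large enough for nothing to be lost, and this is proved after the definition.
\<close>

definition tychonoff_space :: "'a topology \<Rightarrow> bool"
  where "tychonoff_space X \<longleftrightarrow> completely_regular_space X \<and> Hausdorff_space X"

lemma homeomorphic_tychonoff_space:
  "X homeomorphic_space Y \<Longrightarrow> tychonoff_space X \<longleftrightarrow> tychonoff_space Y"
  by (simp add: tychonoff_space_def homeomorphic_completely_regular_space homeomorphic_Hausdorff_space)

lemma homeomorphic_copy:
  fixes X :: "'a topology" and c :: "'a \<Rightarrow> 'b"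
  assumes "inj_on c (topspace X)"
  obtains X' :: "'b topology" and d where "homeomorphic_maps X X' c d"
proof -
  define d where "d = inv_into (topspace X) c"
  define X' where "X' = pullback_topology (c ` topspace X) d X"
  have dc: "d (c x) = x" if "x \<in> topspace X" for x
    using assms that by (simp add: d_def)
  have tX': "topspace X' = c ` topspace X"
    by (auto simp: X'_def topspace_pullback_topology dc)
  have "continuous_map X X' c"
    unfolding X'_def
  proof (rule continuous_map_pullback')
    show "continuous_map X X (d \<circ> c)"
      by (rule continuous_map_eq [OF continuous_map_id]) (simp add: dc)
  qed auto
  moreover have "continuous_map X' X d"
    using continuous_map_pullback [OF continuous_map_id, of "c ` topspace X" d X]
    by (simp add: X'_def)
  ultimately have "homeomorphic_maps X X' c d"
    using dc tX' by (auto simp: homeomorphic_maps_def)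
  then show thesis ..
qed


section \<open>Openly factorizable spaces\<close>

text \<open>
  A second countable Tychonoff space has at most continuum many points, so it has a homeomorphic
  copy carried by a set of reals.  Surjectivity and \<open>f = g \<circ> p\<close> are relativised to the carriers.
\<close>

definition openly_factorizable :: "'a topology \<Rightarrow> bool"
  where "openly_factorizable X \<longleftrightarrow>
    (\<forall>(Y :: real topology) f.
       tychonoff_space Y \<and> second_countable Y \<and> continuous_map X Y f \<longrightarrow>
       (\<exists>(Z :: real topology) p g.
          tychonoff_space Z \<and> second_countable Z \<and>
          continuous_map X Z p \<and> open_map X Z p \<and> p ` topspace X = topspace Z \<and>
          continuous_map Z Y g \<and> (\<forall>x \<in> topspace X. f x = g (p x))))"

lemma second_countable_real_copy:
  fixes X :: "'a topology"
  assumes "tychonoff_space X" "second_countable X"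
  obtains X' :: "real topology" and c d where "homeomorphic_maps X X' c d"
    "tychonoff_space X'" "second_countable X'"
proof -
  obtain \<B> where cB: "countable \<B>" and opB: "\<And>V. V \<in> \<B> \<Longrightarrow> openin X V"
    and B: "\<And>U x. openin X U \<Longrightarrow> x \<in> U \<Longrightarrow> \<exists>V \<in> \<B>. x \<in> V \<and> V \<subseteq> U"
    using assms(2) unfolding second_countable_def by metis
  define s where "s x = {n. \<exists>V\<in>\<B>. to_nat_on \<B> V = n \<and> x \<in> V}" for x
  have "inj_on s (topspace X)"
  proof (rule inj_onI, rule ccontr)
    fix x y assume xy: "x \<in> topspace X" "y \<in> topspace X" "s x = s y" "x \<noteq> y"
    then obtain U where "openin X U" "x \<in> U" "y \<notin> U"
      using assms(1) unfolding tychonoff_space_def Hausdorff_space_def disjnt_iff by metis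
    then obtain V where V: "V \<in> \<B>" "x \<in> V" "V \<subseteq> U"
      using B by blast
    then have "to_nat_on \<B> V \<in> s y"
      using xy(3) unfolding s_def by blast
    then obtain W where "W \<in> \<B>" "to_nat_on \<B> W = to_nat_on \<B> V" "y \<in> W"
      unfolding s_def by blast
    then have "y \<in> V"
      using V(1) cB by (metis inj_onD inj_on_to_nat_on)
    with V(3) \<open>y \<notin> U\<close> show False by blast
  qed
  moreover obtain h :: "nat set \<Rightarrow> real" where "inj h"
    using nat_sets_eqpoll_reals by (meson bij_betw_def eqpoll_def)
  ultimately have "inj_on (h \<circ> s) (topspace X)"
    by (meson comp_inj_on inj_on_subset subset_UNIV)
  then obtain X' :: "real topology" and d where hm: "homeomorphic_maps X X' (h \<circ> s) d"
    by (rule homeomorphic_copy)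
  then have "X homeomorphic_space X'"
    unfolding homeomorphic_space_def by blast
  with assms show thesis
    using that [OF hm] homeomorphic_tychonoff_space homeomorphic_space_second_countability by blast
qed

lemma openly_factorizable_any_type:
  fixes X :: "'a topology"
  assumes "openly_factorizable X"
  fixes Y :: "'b topology"
  assumes Y: "tychonoff_space Y" "second_countable Y" and f: "continuous_map X Y f"
  shows "\<exists>(Z :: real topology) p g.
          tychonoff_space Z \<and> second_countable Z \<and>
          continuous_map X Z p \<and> open_map X Z p \<and> p ` topspace X = topspace Z \<and>
          continuous_map Z Y g \<and> (\<forall>x \<in> topspace X. f x = g (p x))"
proof -
  obtain Y' :: "real topology" and c d where hm: "homeomorphic_maps Y Y' c d"
    and Y': "tychonoff_space Y'" "second_countable Y'"
    using second_countable_real_copy [OF Y] .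
  then have c: "continuous_map Y Y' c" and d: "continuous_map Y' Y d"
    and dc: "\<And>y. y \<in> topspace Y \<Longrightarrow> d (c y) = y"
    by (auto simp: homeomorphic_maps_def)
  have "continuous_map X Y' (c \<circ> f)"
    using f c by (rule continuous_map_compose)
  then obtain Z :: "real topology" and p g where
    Z: "tychonoff_space Z" "second_countable Z" "continuous_map X Z p" "open_map X Z p"
       "p ` topspace X = topspace Z"
    and g: "continuous_map Z Y' g" "\<forall>x \<in> topspace X. (c \<circ> f) x = g (p x)"
    using assms(1) [unfolded openly_factorizable_def, rule_format, of Y' "c \<circ> f"] Y' by auto
  have "continuous_map Z Y (d \<circ> g)"
    using g(1) d by (rule continuous_map_compose)
  moreover have "f x = (d \<circ> g) (p x)" if "x \<in> topspace X" for x
  proof -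
    have "f x \<in> topspace Y" using f that by (auto simp: continuous_map_def)
    with g(2) that dc show ?thesis by (metis comp_apply)
  qed
  ultimately show ?thesis
    using Z by (intro exI [of _ Z] exI [of _ p] exI [of _ "d \<circ> g"]) simp
qed

lemma openly_factorizable_if_any_type:
  fixes X :: "'a topology"
  assumes "\<And>(Y :: real topology) f.
     \<lbrakk>tychonoff_space Y; second_countable Y; continuous_map X Y f\<rbrakk> \<Longrightarrow>
     \<exists>(Z :: 'c topology) p g.
          tychonoff_space Z \<and> second_countable Z \<and>
          continuous_map X Z p \<and> open_map X Z p \<and> p ` topspace X = topspace Z \<and>
          continuous_map Z Y g \<and> (\<forall>x \<in> topspace X. f x = g (p x))"
  shows "openly_factorizable X"
  unfolding openly_factorizable_def
proof (intro allI impI)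
  fix Y :: "real topology" and f
  assume "tychonoff_space Y \<and> second_countable Y \<and> continuous_map X Y f"
  then obtain Z :: "'c topology" and p g where
    Z: "tychonoff_space Z" "second_countable Z" "continuous_map X Z p" "open_map X Z p"
       "p ` topspace X = topspace Z"
    and g: "continuous_map Z Y g" "\<forall>x \<in> topspace X. f x = g (p x)"
    using assms [of Y f] by auto
  obtain Z' :: "real topology" and c d where hm: "homeomorphic_maps Z Z' c d"
    and Z': "tychonoff_space Z'" "second_countable Z'"
    using second_countable_real_copy [OF Z(1,2)] .
  then have d: "continuous_map Z' Z d" and dc: "\<And>z. z \<in> topspace Z \<Longrightarrow> d (c z) = z"
    by (auto simp: homeomorphic_maps_def)
  have hc: "homeomorphic_map Z Z' c"
    using hm homeomorphic_map_maps by blast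
  have "continuous_map X Z' (c \<circ> p)"
    using Z(3) hc continuous_map_compose homeomorphic_imp_continuous_map by blast
  moreover have "open_map X Z' (c \<circ> p)"
    using Z(4) hc open_map_compose homeomorphic_imp_open_map by blast
  moreover have "(c \<circ> p) ` topspace X = topspace Z'"
    using Z(5) hc by (metis homeomorphic_imp_surjective_map image_comp)
  moreover have "continuous_map Z' Y (g \<circ> d)"
    using d g(1) by (rule continuous_map_compose)
  moreover have "\<forall>x \<in> topspace X. f x = (g \<circ> d) ((c \<circ> p) x)"
    using g(2) dc Z(5) by (metis comp_apply image_eqI)
  ultimately show "\<exists>(Z :: real topology) p g.
          tychonoff_space Z \<and> second_countable Z \<and>
          continuous_map X Z p \<and> open_map X Z p \<and> p ` topspace X = topspace Z \<and>
          continuous_map Z Y g \<and> (\<forall>x \<in> topspace X. f x = g (p x))"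
    using Z' by (intro exI [of _ Z'] exI [of _ "c \<circ> p"] exI [of _ "g \<circ> d"]) simp
qed


section \<open>Weakly Lindelof spaces\<close>

definition weakly_Lindelof_space :: "'a topology \<Rightarrow> bool"
  where "weakly_Lindelof_space X \<longleftrightarrow>
    (\<forall>\<U>. (\<forall>U \<in> \<U>. openin X U) \<and> \<Union>\<U> = topspace X \<longrightarrow>
         (\<exists>\<V>. countable \<V> \<and> \<V> \<subseteq> \<U> \<and> X closure_of (\<Union>\<V>) = topspace X))"


section \<open>Real complete spaces\<close>

text \<open>
  The exponent of the power is an index set \<open>I\<close>.  If \<open>X\<close> embeds as a closed subspace of any power of the
  line, it does so in a power indexed by real-valued functions on \<open>X\<close>, hence the index type.
\<close>

definition real_complete_space :: "'a topology \<Rightarrow> bool"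
  where "real_complete_space X \<longleftrightarrow>
    (\<exists>(I :: ('a \<Rightarrow> real) set) S.
       closedin (product_topology (\<lambda>_. euclideanreal) I) S \<and>
       X homeomorphic_space subtopology (product_topology (\<lambda>_. euclideanreal) I) S)"

lemma real_complete_space_any_index:
  fixes X :: "'a topology" and I :: "'i set"
  assumes S: "closedin (product_topology (\<lambda>_. euclideanreal) I) S"
    and hom: "X homeomorphic_space subtopology (product_topology (\<lambda>_. euclideanreal) I) S"
  shows "real_complete_space X"
proof -
  let ?P = "\<lambda>I. product_topology (\<lambda>_. euclideanreal) I"
  obtain h k where h: "continuous_map X (subtopology (?P I) S) h"
    and k: "continuous_map (subtopology (?P I) S) X k"
    and kh: "\<And>x. x \<in> topspace X \<Longrightarrow> k (h x) = x"
    and hk: "\<And>y. y \<in> topspace (subtopology (?P I) S) \<Longrightarrow> h (k y) = y"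
    using hom unfolding homeomorphic_space_def homeomorphic_maps_def by blast
  have hP: "continuous_map X (?P I) h" and hS: "\<And>x. x \<in> topspace X \<Longrightarrow> h x \<in> S"
    using h by (auto simp: continuous_map_in_subtopology)
  have SP: "S \<subseteq> topspace (?P I)" using S by (rule closedin_subset)
  then have tS: "topspace (subtopology (?P I) S) = S" by auto
  define q where "q i = (\<lambda>x. h x i)" for i
  define J where "J = q ` I"
  define r where "r y = (\<lambda>i\<in>I. y (q i))" for y :: "('a \<Rightarrow> real) \<Rightarrow> real"
  define e where "e x = (\<lambda>\<phi>\<in>J. \<phi> x)" for x :: 'a
  have r: "continuous_map (?P J) (?P I) r"
    unfolding continuous_map_componentwise
    by (auto simp: r_def J_def intro!: continuous_map_product_projection)
  have e: "continuous_map X (?P J) e"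
    unfolding continuous_map_componentwise
    using hP by (auto simp: e_def J_def q_def continuous_map_componentwise)
  have re: "r (e x) = h x" if "x \<in> topspace X" for x
  proof
    fix i
    have "h x \<in> extensional I"
      using hS [OF that] SP by (auto simp: PiE_def)
    moreover have "q i \<in> J" if "i \<in> I"
      using that by (simp add: J_def)
    ultimately show "r (e x) i = h x i"
      by (cases "i \<in> I") (simp_all add: r_def e_def extensional_def, simp add: q_def)
  qed
  define T where "T = {y \<in> topspace (?P J). r y \<in> S}"
  have T: "closedin (?P J) T"
    unfolding T_def using r S by (rule closedin_continuous_map_preimage)
  have eT: "e x \<in> T" if "x \<in> topspace X" for x
    using that re hS by (auto simp: T_def e_def)
  have ekr: "e (k (r y)) = y" if "y \<in> T" for y
  proof
    fix \<phi>
    have "h (k (r y)) = r y" using that hk tS by (auto simp: T_def)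
    then have "h (k (r y)) i = y (q i)" if "i \<in> I" for i
      using that by (simp add: r_def)
    then show "e (k (r y)) \<phi> = y \<phi>"
      using that by (auto simp: e_def J_def q_def T_def PiE_def extensional_def)
  qed
  have "homeomorphic_maps X (subtopology (?P J) T) e (k \<circ> r)"
    unfolding homeomorphic_maps_def
  proof (intro conjI)
    show "continuous_map X (subtopology (?P J) T) e"
      using e eT by (auto simp: continuous_map_in_subtopology)
    have "continuous_map (subtopology (?P J) T) (subtopology (?P I) S) r"
      using r by (auto simp: continuous_map_in_subtopology continuous_map_from_subtopology T_def)
    then show "continuous_map (subtopology (?P J) T) X (k \<circ> r)"
      using k by (rule continuous_map_compose)
  qed (use re kh ekr in auto)
  with T show ?thesis
    unfolding real_complete_space_def homeomorphic_space_def by blast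
qed

lemma real_complete_space_real_line_copy:
  assumes "X homeomorphic_space euclideanreal"
  shows "real_complete_space X"
proof (rule real_complete_space_any_index)
  let ?P = "product_topology (\<lambda>_. euclideanreal) {()}"
  show "closedin ?P (topspace ?P)" by (rule closedin_topspace)
  have "homeomorphic_maps euclideanreal ?P (\<lambda>r. \<lambda>u\<in>{()}. r) (\<lambda>y. y ())"
    unfolding homeomorphic_maps_def
    by (auto simp: continuous_map_componentwise fun_eq_iff intro!: continuous_map_product_projection)
  then have "euclideanreal homeomorphic_space ?P"
    unfolding homeomorphic_space_def by blast
  with assms show "X homeomorphic_space subtopology ?P (topspace ?P)"
    using homeomorphic_space_trans by (simp only: subtopology_topspace) blast
qed


section \<open>The Hewitt completion\<close>

text \<open>
  \<open>hewitt_completion X H e\<close>: the space \<open>H\<close>, together with the dense embedding \<open>e\<close> of \<open>X\<close>, is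
  a Hewitt completion of \<open>X\<close>.  Target spaces live on the type \<open>('a \<Rightarrow> real) \<Rightarrow> real\<close>; the
  extension property for targets on all other types follows.
\<close>

definition hewitt_completion :: "'a topology \<Rightarrow> 'h topology \<Rightarrow> ('a \<Rightarrow> 'h) \<Rightarrow> bool"
  where "hewitt_completion X H e \<longleftrightarrow>
    real_complete_space H \<and>
    embedding_map X H e \<and>
    H closure_of (e ` topspace X) = topspace H \<and>
    (\<forall>(Y :: (('a \<Rightarrow> real) \<Rightarrow> real) topology) f.
       real_complete_space Y \<and> continuous_map X Y f \<longrightarrow>
       (\<exists>g. continuous_map H Y g \<and> (\<forall>x \<in> topspace X. g (e x) = f x)))"

lemma extends_to_real_complete:
  fixes X :: "'a topology" and Y :: "'c topology" and H :: "'h topology"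
  assumes dense: "H closure_of (e ` topspace X) = topspace H"
    and real_ext: "\<And>\<phi>. continuous_map X euclideanreal \<phi> \<Longrightarrow>
       \<exists>g. continuous_map H euclideanreal g \<and> (\<forall>x \<in> topspace X. g (e x) = \<phi> x)"
    and Y: "real_complete_space Y" and f: "continuous_map X Y f"
  shows "\<exists>g. continuous_map H Y g \<and> (\<forall>x \<in> topspace X. g (e x) = f x)"
proof -
  let ?P = "\<lambda>I. product_topology (\<lambda>_. euclideanreal) I"
  from Y obtain I :: "('c \<Rightarrow> real) set" and S where S: "closedin (?P I) S"
    and hom: "Y homeomorphic_space subtopology (?P I) S"
    unfolding real_complete_space_def by blast
  from hom obtain h k where h: "continuous_map Y (subtopology (?P I) S) h"
    and k: "continuous_map (subtopology (?P I) S) Y k"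
    and kh: "\<And>y. y \<in> topspace Y \<Longrightarrow> k (h y) = y"
    unfolding homeomorphic_space_def homeomorphic_maps_def by blast
  have SP: "S \<subseteq> topspace (?P I)" using S by (rule closedin_subset)
  have hf: "continuous_map X (subtopology (?P I) S) (h \<circ> f)"
    using f h by (rule continuous_map_compose)
  then have hfP: "continuous_map X (?P I) (h \<circ> f)" and hfS: "\<And>x. x \<in> topspace X \<Longrightarrow> h (f x) \<in> S"
    by (auto simp: continuous_map_in_subtopology)
  have "\<forall>i\<in>I. \<exists>g. continuous_map H euclideanreal g \<and> (\<forall>x \<in> topspace X. g (e x) = h (f x) i)"
  proof
    fix i assume "i \<in> I"
    with hfP have "continuous_map X euclideanreal (\<lambda>x. h (f x) i)"
      by (simp add: continuous_map_componentwise)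
    then show "\<exists>g. continuous_map H euclideanreal g \<and> (\<forall>x \<in> topspace X. g (e x) = h (f x) i)"
      by (rule real_ext)
  qed
  from bchoice [OF this] obtain G
    where "\<forall>i\<in>I. continuous_map H euclideanreal (G i) \<and> (\<forall>x \<in> topspace X. G i (e x) = h (f x) i)" ..
  then have G: "\<And>i. i \<in> I \<Longrightarrow> continuous_map H euclideanreal (G i)"
    and Ge: "\<And>i x. i \<in> I \<Longrightarrow> x \<in> topspace X \<Longrightarrow> G i (e x) = h (f x) i"
    by simp_all
  define g where "g z = (\<lambda>i\<in>I. G i z)" for z
  have g: "continuous_map H (?P I) g"
    unfolding continuous_map_componentwise using G by (auto simp: g_def)
  have ge: "g (e x) = h (f x)" if "x \<in> topspace X" for x
  proof (rule ext)
    fix i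
    have "h (f x) \<in> extensional I"
      using hfS [OF that] SP by (auto simp: PiE_def)
    then show "g (e x) i = h (f x) i"
      using Ge [OF _ that] by (cases "i \<in> I") (simp_all add: g_def extensional_def)
  qed
  have "g ` (H closure_of (e ` topspace X)) \<subseteq> ?P I closure_of (g ` e ` topspace X)"
    using g by (rule continuous_map_image_closure_subset)
  also have "\<dots> \<subseteq> S"
    by (rule closure_of_minimal [OF _ S]) (use ge hfS in auto)
  finally have "continuous_map H (subtopology (?P I) S) g"
    using g dense by (auto simp: continuous_map_in_subtopology)
  then have "continuous_map H Y (k \<circ> g)"
    using k by (rule continuous_map_compose)
  moreover have "(k \<circ> g) (e x) = f x" if "x \<in> topspace X" for x
  proof -
    have "f x \<in> topspace Y" using f that by (auto simp: continuous_map_def)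
    then show ?thesis using ge kh that by simp
  qed
  ultimately show ?thesis by (intro exI conjI ballI)
qed

lemma hewitt_completion_extension_any_type:
  fixes X :: "'a topology" and Y :: "'c topology"
  assumes H: "hewitt_completion X H e" and "real_complete_space Y" "continuous_map X Y f"
  shows "\<exists>g. continuous_map H Y g \<and> (\<forall>x \<in> topspace X. g (e x) = f x)"
proof (rule extends_to_real_complete)
  fix \<phi> assume phi: "continuous_map X euclideanreal \<phi>"
  let ?c = "\<lambda>(r::real) (_ :: 'a \<Rightarrow> real). r"
  have "inj_on ?c (topspace euclideanreal)"
    by (auto simp: inj_on_def fun_eq_iff)
  then obtain R :: "(('a \<Rightarrow> real) \<Rightarrow> real) topology" and d
    where R: "homeomorphic_maps euclideanreal R ?c d"
    by (rule homeomorphic_copy)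
  then have "R homeomorphic_space euclideanreal"
    using homeomorphic_space_sym unfolding homeomorphic_space_def by blast
  then have "real_complete_space R"
    by (rule real_complete_space_real_line_copy)
  moreover have "continuous_map X R (?c \<circ> \<phi>)"
    using R phi unfolding homeomorphic_maps_def by (metis continuous_map_compose)
  ultimately obtain g where g: "continuous_map H R g" "\<forall>x \<in> topspace X. g (e x) = (?c \<circ> \<phi>) x"
    using H unfolding hewitt_completion_def by blast
  have "continuous_map H euclideanreal (d \<circ> g)"
    using R g(1) unfolding homeomorphic_maps_def by (metis continuous_map_compose)
  moreover have "\<forall>x \<in> topspace X. (d \<circ> g) (e x) = \<phi> x"
    using g(2) R by (simp add: homeomorphic_maps_def)
  ultimately show "\<exists>g. continuous_map H euclideanreal g \<and> (\<forall>x \<in> topspace X. g (e x) = \<phi> x)"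
    by blast
qed (use assms in \<open>auto simp: hewitt_completion_def\<close>)

lemma hewitt_completion_exists:
  fixes X :: "'a topology"
  assumes "tychonoff_space X"
  shows "\<exists>(H :: (('a \<Rightarrow> real) \<Rightarrow> real) topology) e. hewitt_completion X H e"
proof -
  define C where "C = {\<phi>. continuous_map X euclideanreal \<phi>}"
  let ?P = "product_topology (\<lambda>_. euclideanreal) C"
  define e where "e x = (\<lambda>\<phi>\<in>C. \<phi> x)" for x :: 'a
  define S where "S = ?P closure_of (e ` topspace X)"
  define H where "H = subtopology ?P S"
  have S: "closedin ?P S" by (simp add: S_def)
  have eP: "continuous_map X ?P e"
    unfolding continuous_map_componentwise by (auto simp: e_def C_def)
  then have sub: "e ` topspace X \<subseteq> topspace ?P"
    by (rule continuous_map_image_subset_topspace)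
  then have eS: "e ` topspace X \<subseteq> S"
    unfolding S_def by (rule closure_of_subset)
  have eH: "continuous_map X H e"
    using eP eS by (auto simp: H_def continuous_map_in_subtopology)
  have dense: "H closure_of (e ` topspace X) = topspace H"
    using eS closedin_subset [OF S]
    by (simp add: H_def closure_of_subtopology Int_absorb1 S_def [symmetric])
  have sep: "\<exists>\<phi>\<in>C. \<phi> x = 0 \<and> \<phi> ` (topspace X - U) \<subseteq> {1}" if "openin X U" "x \<in> U" for U x
  proof -
    have "closedin X (topspace X - U)" "x \<in> topspace X - (topspace X - U)"
      using that openin_subset by fastforce+
    then obtain \<phi> where "continuous_map X (top_of_set {0..1::real}) \<phi>" "\<phi> x = 0"
      "\<phi> ` (topspace X - U) \<subseteq> {1}"
      using assms unfolding tychonoff_space_def completely_regular_space_def by blast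
    then show ?thesis
      unfolding C_def continuous_map_in_subtopology by blast
  qed
  have inj: "inj_on e (topspace X)"
  proof (rule inj_onI, rule ccontr)
    fix x y assume xy: "x \<in> topspace X" "y \<in> topspace X" "e x = e y" "x \<noteq> y"
    then obtain U where U: "openin X U" "x \<in> U" "y \<notin> U"
      using assms(1) unfolding tychonoff_space_def Hausdorff_space_def disjnt_iff by metis
    obtain \<phi> where "\<phi> \<in> C" "\<phi> x = 0" "\<phi> ` (topspace X - U) \<subseteq> {1}"
      using sep [OF U(1,2)] by blast
    moreover from this U xy have "\<phi> y = 1" by blast
    ultimately show False
      using fun_cong [OF xy(3), of \<phi>] by (simp add: e_def)
  qed
  have op: "open_map X (subtopology H (e ` topspace X)) e"
    unfolding open_map_def
  proof (intro allI impI)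
    fix U assume U: "openin X U"
    show "openin (subtopology H (e ` topspace X)) (e ` U)"
    proof (subst openin_subopen, intro ballI)
      fix z assume "z \<in> e ` U"
      then obtain x where x: "x \<in> U" "z = e x" by blast
      obtain \<phi> where phi: "\<phi> \<in> C" "\<phi> x = 0" "\<phi> ` (topspace X - U) \<subseteq> {1}"
        using sep [OF U x(1)] by blast
      define W where "W = {y \<in> topspace ?P. y \<phi> \<in> {..<1}}"
      have W: "openin ?P W"
        unfolding W_def
        by (rule openin_continuous_map_preimage [OF continuous_map_product_projection])
          (use phi in auto)
      have UX: "U \<subseteq> topspace X" using U by (rule openin_subset)
      have "openin (subtopology H (e ` topspace X)) (W \<inter> e ` topspace X)"
        using W eS unfolding H_def subtopology_subtopology
        by (simp add: Int_absorb1 openin_subtopology_Int)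
      moreover have "z \<in> W \<inter> e ` topspace X"
        using x phi UX sub by (auto simp: W_def e_def)
      moreover have "W \<inter> e ` topspace X \<subseteq> e ` U"
      proof
        fix y assume "y \<in> W \<inter> e ` topspace X"
        then obtain x' where x': "x' \<in> topspace X" "y = e x'" and "y \<phi> < 1"
          by (auto simp: W_def)
        then have "\<phi> x' < 1" using phi(1) by (simp add: e_def)
        then have "x' \<in> U" using phi(3) x'(1) by force
        with x'(2) show "y \<in> e ` U" by blast
      qed
      ultimately show "\<exists>T. openin (subtopology H (e ` topspace X)) T \<and> z \<in> T \<and> T \<subseteq> e ` U"
        by blast
    qed
  qed
  have cont: "continuous_map X (subtopology H (e ` topspace X)) e"
    using eH by (auto simp: continuous_map_in_subtopology)
  have onto: "e ` topspace X = topspace (subtopology H (e ` topspace X))"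
    using continuous_map_image_subset_topspace [OF eH] by auto
  have emb: "embedding_map X H e"
    unfolding embedding_map_def
    by (rule bijective_open_imp_homeomorphic_map [OF cont op onto inj])
  have rc: "real_complete_space H"
    by (rule real_complete_space_any_index [OF S]) (simp add: H_def)
  have real_ext: "\<exists>g. continuous_map H euclideanreal g \<and> (\<forall>x \<in> topspace X. g (e x) = \<phi> x)"
    if "continuous_map X euclideanreal \<phi>" for \<phi>
  proof (intro exI conjI)
    show "continuous_map H euclideanreal (\<lambda>z. z \<phi>)"
      unfolding H_def
      by (intro continuous_map_from_subtopology continuous_map_product_projection)
        (use that in \<open>simp add: C_def\<close>)
    show "\<forall>x\<in>topspace X. e x \<phi> = \<phi> x"
      using that by (simp add: e_def C_def)
  qed
  have "\<exists>g. continuous_map H Y g \<and> (\<forall>x \<in> topspace X. g (e x) = f x)"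
    if "real_complete_space Y" "continuous_map X Y f"
    for Y :: "(('a \<Rightarrow> real) \<Rightarrow> real) topology" and f
    by (rule extends_to_real_complete [OF dense real_ext that])
  then have "hewitt_completion X H e"
    unfolding hewitt_completion_def using rc emb dense by simp
  then show ?thesis by blast
qed

end

theory Submission
  imports Defs
begin

text \<open>
  Everything rests on one factorization: if \<open>X\<close> and \<open>Y\<close> are openly factorizable and \<open>X \<times> Y\<close> is weakly
  Lindelof, then every continuous \<open>f\<close> from \<open>X \<times> Y\<close> to a second countable space \<open>M\<close> is \<open>g \<circ> (p \<times> q)\<close>,
  where \<open>p\<close> and \<open>q\<close> are continuous open surjections of \<open>X\<close> and of \<open>Y\<close> onto second countable spaces
  (\<open>factorizes_through_product_of_open_maps\<close>).

  To find \<open>p\<close> and \<open>q\<close>, take basic open sets \<open>V\<close> and \<open>W\<close> of \<open>M\<close> with the closure of \<open>V\<close> inside \<open>W\<close>.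
  Weak Lindelofness gives countably many products of cozero sets inside the preimage of \<open>W\<close>
  whose union \<open>S\<close> is dense in the preimage of \<open>V\<close> (\<open>weakly_Lindelof_prod_cozero_rectangles\<close>).  There
  are countably many pairs \<open>(V, W)\<close>, so only countably many functions on \<open>X\<close> and on \<open>Y\<close> define
  these cozero sets, and open factorizability provides open maps \<open>p\<close> and \<open>q\<close> on whose fibres all
  those functions are constant.  Each \<open>S\<close> is then a union of fibres of \<open>r = p \<times> q\<close>.  Since \<open>r\<close> is
  open, so is the closure of \<open>S\<close> (\<open>open_map_closure_of_saturated\<close>).  Now let \<open>r u = r u'\<close>.  If \<open>f u\<close> lies
  in \<open>V\<close>, then \<open>u\<close> lies in the closure of \<open>S\<close>, hence so does \<open>u'\<close>, and \<open>f u'\<close> lies in the closure of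
  \<open>W\<close>.  As \<open>M\<close> is regular and Hausdorff, this forces \<open>f u = f u'\<close>.  So \<open>f\<close> descends along \<open>r\<close>, and the
  induced map \<open>g\<close> is continuous because an open surjection is a quotient map.

  For the first claim, \<open>p \<times> q\<close> is itself an open map onto a second countable space.  For the
  second claim it is enough to extend real functions, because the target \<open>\<upsilon>Z\<close> is closed in a power of
  the line.  A real function on \<open>X \<times> Y\<close> is \<open>g \<circ> (p \<times> q)\<close>, the ranges of \<open>p\<close> and \<open>q\<close> are real
  complete since they are Lindelof (\<open>Lindelof_tychonoff_imp_real_complete\<close>), and so \<open>p\<close> and \<open>q\<close> extend
  to \<open>P\<close> and \<open>Q\<close> on the Hewitt completions; \<open>g \<circ> (P \<times> Q)\<close> is the extension sought.
\<close>

section \<open>Cozero rectangles in weakly Lindelof products\<close>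

definition cozero :: "'a topology \<Rightarrow> ('a \<Rightarrow> real) \<Rightarrow> 'a set"
  where "cozero X \<phi> = {x \<in> topspace X. \<phi> x \<noteq> 0}"

lemma openin_cozero:
  assumes "continuous_map X euclideanreal \<phi>"
  shows "openin X (cozero X \<phi>)"
proof -
  have "openin X {x \<in> topspace X. \<phi> x \<in> - {0}}"
    by (rule openin_continuous_map_preimage [OF assms]) auto
  then show ?thesis by (simp add: cozero_def)
qed

text \<open>
  Weak Lindelofness passes to the closure of an open set: complete the cover by the complement of
  that closure.  The added set misses \<open>G\<close>, so it is irrelevant to density in \<open>G\<close>.
\<close>

lemma weakly_Lindelof_countable_dense_subfamily:
  assumes X: "weakly_Lindelof_space X" and G: "openin X G"
    and \<U>: "\<And>U. U \<in> \<U> \<Longrightarrow> openin X U" and cover: "X closure_of G \<subseteq> \<Union>\<U>"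
  shows "\<exists>\<V>. countable \<V> \<and> \<V> \<subseteq> \<U> \<and> G \<subseteq> X closure_of \<Union>\<V>"
proof -
  let ?N = "topspace X - X closure_of G"
  have N: "openin X ?N"
    by (simp add: openin_diff)
  then have "\<forall>U \<in> insert ?N \<U>. openin X U"
    using \<U> by blast
  moreover have "\<Union>(insert ?N \<U>) = topspace X"
  proof
    show "\<Union>(insert ?N \<U>) \<subseteq> topspace X"
      using \<U> by (auto dest: openin_subset)
    show "topspace X \<subseteq> \<Union>(insert ?N \<U>)"
      using cover by auto
  qed
  ultimately obtain \<W> where \<W>: "countable \<W>" "\<W> \<subseteq> insert ?N \<U>"
      and dense: "X closure_of \<Union>\<W> = topspace X"
    using X [unfolded weakly_Lindelof_space_def, rule_format, of "insert ?N \<U>"] by blast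
  have "G \<subseteq> X closure_of \<Union>(\<W> \<inter> \<U>)"
  proof
    fix x assume x: "x \<in> G"
    have "\<exists>w. w \<in> \<Union>(\<W> \<inter> \<U>) \<and> w \<in> T" if T: "x \<in> T" "openin X T" for T
    proof -
      have TG: "openin X (T \<inter> G)" "x \<in> T \<inter> G"
        using T G x by auto
      have "x \<in> X closure_of \<Union>\<W>"
        using dense x openin_subset [OF G] by auto
      then obtain w where w: "w \<in> \<Union>\<W>" "w \<in> T \<inter> G"
        using TG unfolding in_closure_of by metis
      then have "w \<notin> ?N"
        using closure_of_subset [OF openin_subset [OF G]] by blast
      with w \<W>(2) show ?thesis by auto
    qed
    then show "x \<in> X closure_of \<Union>(\<W> \<inter> \<U>)"
      using x openin_subset [OF G] unfolding in_closure_of by blast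
  qed
  then show ?thesis
    using \<W>(1) by (intro exI [of _ "\<W> \<inter> \<U>"]) auto
qed

lemma cozero_neighbourhood:
  assumes "completely_regular_space X" "openin X U" "x \<in> U"
  shows "\<exists>\<phi>. continuous_map X euclideanreal \<phi> \<and> x \<in> cozero X \<phi> \<and> cozero X \<phi> \<subseteq> U"
proof -
  obtain \<phi> where \<phi>: "continuous_map X euclideanreal \<phi>" "\<phi> x = 0" "\<phi> ` (topspace X - U) \<subseteq> {1}"
    using assms unfolding completely_regular_space_alt' by blast
  have "continuous_map X euclideanreal (\<lambda>x. \<phi> x - 1)"
    using \<phi>(1) by (intro continuous_map_diff) auto
  moreover have "x \<in> cozero X (\<lambda>x. \<phi> x - 1)"
    using assms openin_subset \<phi>(2) by (fastforce simp: cozero_def)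
  moreover have "cozero X (\<lambda>x. \<phi> x - 1) \<subseteq> U"
    using \<phi>(3) by (auto simp: cozero_def)
  ultimately show ?thesis by blast
qed

lemma weakly_Lindelof_prod_cozero_rectangles:
  assumes X: "completely_regular_space X" and Y: "completely_regular_space Y"
    and XY: "weakly_Lindelof_space (prod_topology X Y)"
    and G: "openin (prod_topology X Y) G" and W: "openin (prod_topology X Y) W"
    and GW: "prod_topology X Y closure_of G \<subseteq> W"
  shows "\<exists>\<P>. countable \<P> \<and>
     (\<forall>\<phi> \<psi>. (\<phi>,\<psi>) \<in> \<P> \<longrightarrow> continuous_map X euclideanreal \<phi> \<and> continuous_map Y euclideanreal \<psi> \<and>
        cozero X \<phi> \<times> cozero Y \<psi> \<subseteq> W) \<and>
     G \<subseteq> prod_topology X Y closure_of (\<Union>(\<phi>,\<psi>) \<in> \<P>. cozero X \<phi> \<times> cozero Y \<psi>)"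
proof -
  define \<Q> where "\<Q> = {(\<phi>,\<psi>). continuous_map X euclideanreal \<phi> \<and> continuous_map Y euclideanreal \<psi> \<and>
        cozero X \<phi> \<times> cozero Y \<psi> \<subseteq> W}"
  define R where "R = (\<lambda>(\<phi>,\<psi>). cozero X \<phi> \<times> cozero Y \<psi>)"
  have op: "openin (prod_topology X Y) U" if "U \<in> R ` \<Q>" for U
    using that by (auto simp: R_def \<Q>_def openin_prod_Times_iff openin_cozero)
  have "W \<subseteq> \<Union>(R ` \<Q>)"
  proof clarify
    fix x y assume "(x, y) \<in> W"
    then obtain U V where UV: "openin X U" "openin Y V" "x \<in> U" "y \<in> V" "U \<times> V \<subseteq> W"
      using W unfolding openin_prod_topology_alt by meson
    obtain \<phi> where "continuous_map X euclideanreal \<phi>" "x \<in> cozero X \<phi>" "cozero X \<phi> \<subseteq> U"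
      using cozero_neighbourhood [OF X UV(1,3)] by blast
    moreover obtain \<psi> where "continuous_map Y euclideanreal \<psi>" "y \<in> cozero Y \<psi>" "cozero Y \<psi> \<subseteq> V"
      using cozero_neighbourhood [OF Y UV(2,4)] by blast
    ultimately have "(\<phi>, \<psi>) \<in> \<Q>" "(x, y) \<in> R (\<phi>, \<psi>)"
      using UV(5) by (auto simp: \<Q>_def R_def)
    then show "(x, y) \<in> \<Union>(R ` \<Q>)" by blast
  qed
  with GW have cover: "prod_topology X Y closure_of G \<subseteq> \<Union>(R ` \<Q>)" by blast
  obtain \<V> where "countable \<V>" "\<V> \<subseteq> R ` \<Q>" and G: "G \<subseteq> prod_topology X Y closure_of \<Union>\<V>"
    using weakly_Lindelof_countable_dense_subfamily [OF XY G op cover] by blast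
  then obtain \<P> where \<P>: "countable \<P>" "\<P> \<subseteq> \<Q>" "\<V> = R ` \<P>"
    by (metis countable_subset_image)
  show ?thesis
    using \<P> G by (intro exI [of _ \<P>]) (auto simp: \<Q>_def R_def)
qed

section \<open>Open factorization of countable families of functions\<close>

lemma tychonoff_euclidean:
  "tychonoff_space (euclidean :: 'a::metric_space topology)"
  by (simp add: tychonoff_space_def metrizable_space_euclidean
      metrizable_imp_completely_regular_space)

lemma second_countable_euclidean:
  "second_countable (euclidean :: 'a::second_countable_topology topology)"
proof -
  obtain \<B> :: "'a set set" where "countable \<B>" and \<B>: "topological_basis \<B>"
    using ex_countable_basis [where 'a = 'a] by blast
  moreover have "\<And>V. V \<in> \<B> \<Longrightarrow> open V"
    using \<B> by (rule topological_basis_open)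
  moreover have "\<exists>V \<in> \<B>. x \<in> V \<and> V \<subseteq> U" if "open U" "x \<in> U" for U x
    by (rule topological_basisE [OF \<B> that]) blast
  ultimately show ?thesis
    unfolding second_countable_def open_openin [symmetric] by blast
qed

text \<open>
  Countably many real functions are the coordinates of a single map into the second countable space
  of real sequences, and that map is factored through an open one.
\<close>

lemma openly_factorizable_countable_family:
  fixes X :: "'a topology"
  assumes X: "openly_factorizable X" and "countable A"
    and A: "\<And>\<phi>. \<phi> \<in> A \<Longrightarrow> continuous_map X euclideanreal \<phi>"
  shows "\<exists>(Z :: real topology) p. tychonoff_space Z \<and> second_countable Z \<and>
      continuous_map X Z p \<and> open_map X Z p \<and> p ` topspace X = topspace Z \<and>
      (\<forall>\<phi> \<in> A. \<forall>x \<in> topspace X. \<forall>x' \<in> topspace X. p x = p x' \<longrightarrow> \<phi> x = \<phi> x')"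
proof -
  \<comment> \<open>The constant function makes the family nonempty, so that it can be listed as a sequence.\<close>
  define s where "s = from_nat_into (insert (\<lambda>_. 0) A)"
  have range: "range s = insert (\<lambda>_. 0) A"
    unfolding s_def using \<open>countable A\<close> by (intro range_from_nat_into) auto
  define \<Phi> where "\<Phi> x = (\<lambda>n. s n x)" for x
  have "continuous_map X euclideanreal (s n)" for n
  proof -
    have "s n \<in> insert (\<lambda>_. 0) A" using range by blast
    then show ?thesis using A by auto
  qed
  then have "continuous_map X (euclidean :: (nat \<Rightarrow> real) topology) \<Phi>"
    by (simp add: \<Phi>_def continuous_map_componentwise_UNIV flip: euclidean_product_topology)
  moreover note tychonoff_euclidean
  moreover note second_countable_euclidean
  ultimately obtain Z :: "real topology" and p g where
    Z: "tychonoff_space Z" "second_countable Z" "continuous_map X Z p" "open_map X Z p"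
       "p ` topspace X = topspace Z"
    and g: "\<forall>x \<in> topspace X. \<Phi> x = g (p x)"
    using openly_factorizable_any_type [OF X, of euclidean \<Phi>] by blast
  have "\<phi> x = \<phi> x'" if "\<phi> \<in> A" "x \<in> topspace X" "x' \<in> topspace X" "p x = p x'" for \<phi> x x'
  proof -
    obtain n where "\<phi> = s n" using range \<open>\<phi> \<in> A\<close> by blast
    moreover have "\<Phi> x = \<Phi> x'" using g that by metis
    ultimately show ?thesis unfolding \<Phi>_def by metis
  qed
  with Z show ?thesis by blast
qed

section \<open>Open maps and products\<close>

text \<open>
  The closure of a saturated set is saturated if the map is open: a neighbourhood \<open>N\<close> of \<open>u'\<close> gives the
  neighbourhood of \<open>u\<close> formed by the fibres that meet \<open>N\<close>.  It meets \<open>S\<close>, and by saturation it does so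
  in a fibre that meets \<open>N\<close> inside \<open>S\<close>.
\<close>

lemma open_map_closure_of_saturated:
  assumes r: "continuous_map T Z r" "open_map T Z r"
    and sat: "\<And>u u'. u \<in> S \<Longrightarrow> u' \<in> topspace T \<Longrightarrow> r u = r u' \<Longrightarrow> u' \<in> S"
    and u: "u \<in> T closure_of S" "u' \<in> topspace T" "r u = r u'"
  shows "u' \<in> T closure_of S"
proof -
  have "\<exists>w. w \<in> S \<and> w \<in> N" if N: "u' \<in> N" "openin T N" for N
  proof -
    define P where "P = {v \<in> topspace T. r v \<in> r ` N}"
    have "openin Z (r ` N)"
      using r(2) N(2) by (simp add: open_map_def)
    then have P: "openin T P"
      unfolding P_def by (rule openin_continuous_map_preimage [OF r(1)])
    have "u \<in> P"
      using u N(1) by (auto simp: in_closure_of P_def)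
    with P obtain v where v: "v \<in> S" "v \<in> P"
      using u(1) unfolding in_closure_of by metis
    then obtain w where w: "w \<in> N" "r v = r w"
      by (auto simp: P_def)
    then have "w \<in> S"
      using sat [OF v(1)] openin_subset [OF N(2)] by auto
    with w show ?thesis by blast
  qed
  with u(2) show ?thesis unfolding in_closure_of by simp
qed

lemma open_map_prod:
  assumes p: "open_map X Z p" and q: "open_map Y Z' q"
  shows "open_map (prod_topology X Y) (prod_topology Z Z') (\<lambda>(x,y). (p x, q y))"
  unfolding open_map_def
proof (intro allI impI)
  fix S assume S: "openin (prod_topology X Y) S"
  show "openin (prod_topology Z Z') ((\<lambda>(x,y). (p x, q y)) ` S)"
    unfolding openin_prod_topology_alt
  proof (intro allI impI)
    fix a b assume "(a, b) \<in> (\<lambda>(x,y). (p x, q y)) ` S"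
    then obtain x y where xy: "(x, y) \<in> S" "a = p x" "b = q y" by auto
    then obtain U V where UV: "openin X U" "openin Y V" "x \<in> U" "y \<in> V" "U \<times> V \<subseteq> S"
      using S unfolding openin_prod_topology_alt by meson
    have "openin Z (p ` U)" "openin Z' (q ` V)"
      using p q UV by (auto simp: open_map_def)
    moreover have "p ` U \<times> q ` V \<subseteq> (\<lambda>(x,y). (p x, q y)) ` S"
      using UV(5) by force
    ultimately show "\<exists>U V. openin Z U \<and> openin Z' V \<and> a \<in> U \<and> b \<in> V \<and>
        U \<times> V \<subseteq> (\<lambda>(x,y). (p x, q y)) ` S"
      using xy UV by blast
  qed
qed

lemma second_countable_prod_topology:
  assumes "second_countable X" "second_countable Y"
  shows "second_countable (prod_topology X Y)"
proof -
  obtain \<B> where \<B>: "countable \<B>" "\<And>V. V \<in> \<B> \<Longrightarrow> openin X V"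
    "\<And>U x. openin X U \<Longrightarrow> x \<in> U \<Longrightarrow> \<exists>V \<in> \<B>. x \<in> V \<and> V \<subseteq> U"
    using assms(1) unfolding second_countable_def by metis
  obtain \<C> where \<C>: "countable \<C>" "\<And>V. V \<in> \<C> \<Longrightarrow> openin Y V"
    "\<And>U x. openin Y U \<Longrightarrow> x \<in> U \<Longrightarrow> \<exists>V \<in> \<C>. x \<in> V \<and> V \<subseteq> U"
    using assms(2) unfolding second_countable_def by metis
  let ?\<D> = "(\<lambda>(V, W). V \<times> W) ` (\<B> \<times> \<C>)"
  have "\<exists>D \<in> ?\<D>. z \<in> D \<and> D \<subseteq> S" if S: "openin (prod_topology X Y) S" "z \<in> S" for S z
  proof -
    obtain x y where z: "z = (x, y)" by fastforce
    with S obtain U U' where U: "openin X U" "openin Y U'" "x \<in> U" "y \<in> U'" "U \<times> U' \<subseteq> S"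
      unfolding openin_prod_topology_alt by meson
    obtain V W where "V \<in> \<B>" "x \<in> V" "V \<subseteq> U" "W \<in> \<C>" "y \<in> W" "W \<subseteq> U'"
      using \<B>(3) \<C>(3) U by meson
    then have "V \<times> W \<in> ?\<D>" "z \<in> V \<times> W" "V \<times> W \<subseteq> S"
      using U(5) z by auto
    then show ?thesis by blast
  qed
  moreover have "countable ?\<D>"
    using \<B>(1) \<C>(1) by blast
  moreover have "\<forall>D \<in> ?\<D>. openin (prod_topology X Y) D"
    using \<B>(2) \<C>(2) by (auto simp: openin_prod_Times_iff)
  ultimately show ?thesis
    unfolding second_countable_def by blast
qed

section \<open>Factorization through a product of open maps\<close>

lemma regular_space_shrink_neighbourhood:
  assumes "regular_space X" "openin X U" "x \<in> U"
  shows "\<exists>V. openin X V \<and> x \<in> V \<and> X closure_of V \<subseteq> U"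
proof -
  have "neighbourhood_base_of (closedin X) X"
    using assms(1) by (simp add: neighbourhood_base_of_closedin)
  then obtain V C where "openin X V" "closedin X C" "x \<in> V" "V \<subseteq> C" "C \<subseteq> U"
    using assms(2,3) unfolding neighbourhood_base_of by metis
  moreover from this have "X closure_of V \<subseteq> C"
    by (intro closure_of_minimal)
  ultimately show ?thesis by (intro exI [of _ V]) simp
qed

text \<open>
  The key step.  Weak Lindelofness reduces the preimages under \<open>f\<close> of the basic open sets, up to
  closures, to countably many functions of one variable, and open factorizability of each factor
  handles these.
  Openness of \<open>p\<close> and \<open>q\<close> is used twice: to pass to closures and to make \<open>g\<close> continuous.
\<close>

lemma factorizes_through_product_of_open_maps:
  fixes X :: "'a topology" and Y :: "'b topology" and M :: "'c topology"
  assumes X: "completely_regular_space X" "openly_factorizable X"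
    and Y: "completely_regular_space Y" "openly_factorizable Y"
    and XY: "weakly_Lindelof_space (prod_topology X Y)"
    and M: "tychonoff_space M" "second_countable M"
    and f: "continuous_map (prod_topology X Y) M f"
  shows "\<exists>(Z :: real topology) (Z' :: real topology) p q g.
     tychonoff_space Z \<and> second_countable Z \<and>
     continuous_map X Z p \<and> open_map X Z p \<and> p ` topspace X = topspace Z \<and>
     tychonoff_space Z' \<and> second_countable Z' \<and>
     continuous_map Y Z' q \<and> open_map Y Z' q \<and> q ` topspace Y = topspace Z' \<and>
     continuous_map (prod_topology Z Z') M g \<and>
     (\<forall>x \<in> topspace X. \<forall>y \<in> topspace Y. f (x, y) = g (p x, q y))"
proof -
  let ?XY = "prod_topology X Y"
  let ?pre = "\<lambda>S. {u \<in> topspace ?XY. f u \<in> S}"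
  let ?R = "\<lambda>\<P>. \<Union>(\<phi>,\<psi>) \<in> \<P>. cozero X \<phi> \<times> cozero Y \<psi>"
  obtain \<B> where \<B>: "countable \<B>" and op\<B>: "\<And>V. V \<in> \<B> \<Longrightarrow> openin M V"
    and base: "\<And>U x. openin M U \<Longrightarrow> x \<in> U \<Longrightarrow> \<exists>V \<in> \<B>. x \<in> V \<and> V \<subseteq> U"
    using M(2) unfolding second_countable_def by metis
  \<comment> \<open>Rectangles can only be made dense in the preimage of a smaller set, hence pairs \<open>(V, W)\<close>.\<close>
  define \<I> where "\<I> = {(V, W) \<in> \<B> \<times> \<B>. M closure_of V \<subseteq> W}"
  have \<I>: "countable \<I>"
    using \<B> by (rule_tac countable_subset [of _ "\<B> \<times> \<B>"]) (auto simp: \<I>_def)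
  define rectangles where "rectangles i \<P> \<longleftrightarrow> countable \<P> \<and>
     (\<forall>\<phi> \<psi>. (\<phi>,\<psi>) \<in> \<P> \<longrightarrow> continuous_map X euclideanreal \<phi> \<and> continuous_map Y euclideanreal \<psi> \<and>
        cozero X \<phi> \<times> cozero Y \<psi> \<subseteq> ?pre (snd i)) \<and>
     ?pre (fst i) \<subseteq> ?XY closure_of (?R \<P>)" for i \<P>
  have "\<exists>\<P>. rectangles i \<P>" if "i \<in> \<I>" for i
    unfolding rectangles_def
  proof (rule weakly_Lindelof_prod_cozero_rectangles [OF X(1) Y(1) XY])
    have i: "openin M (fst i)" "openin M (snd i)" "M closure_of fst i \<subseteq> snd i"
      using that op\<B> by (auto simp: \<I>_def)
    show "openin ?XY (?pre (fst i))" "openin ?XY (?pre (snd i))"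
      by (rule openin_continuous_map_preimage [OF f i(1)],
          rule openin_continuous_map_preimage [OF f i(2)])
    have "closedin ?XY (?pre (M closure_of fst i))"
      by (rule closedin_continuous_map_preimage [OF f]) simp
    moreover have "?pre (fst i) \<subseteq> ?pre (M closure_of fst i)"
      using closure_of_subset [OF openin_subset [OF i(1)]] by blast
    ultimately have "?XY closure_of ?pre (fst i) \<subseteq> ?pre (M closure_of fst i)"
      by (rule closure_of_minimal [rotated])
    also have "\<dots> \<subseteq> ?pre (snd i)"
      using i(3) by blast
    finally show "?XY closure_of ?pre (fst i) \<subseteq> ?pre (snd i)" .
  qed
  then obtain \<P> where \<P>: "\<And>i. i \<in> \<I> \<Longrightarrow> rectangles i (\<P> i)"
    by metis
  have c\<P>: "countable (\<P> i)" and \<P>V: "?pre (fst i) \<subseteq> ?XY closure_of (?R (\<P> i))"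
    if "i \<in> \<I>" for i
    using \<P> [OF that] by (simp_all add: rectangles_def)
  have cont\<P>: "continuous_map X euclideanreal \<phi>" "continuous_map Y euclideanreal \<psi>"
    and sub\<P>: "cozero X \<phi> \<times> cozero Y \<psi> \<subseteq> ?pre (snd i)"
    if "i \<in> \<I>" "(\<phi>,\<psi>) \<in> \<P> i" for i \<phi> \<psi>
    using \<P> [OF that(1)] that(2) unfolding rectangles_def by simp_all
  have \<P>W: "?R (\<P> i) \<subseteq> ?pre (snd i)" if "i \<in> \<I>" for i
    using sub\<P> [OF that] by fast
  define \<A> where "\<A> = (\<Union>i \<in> \<I>. \<P> i)"
  have \<A>: "countable \<A>" using \<I> c\<P> by (simp add: \<A>_def)
  have cont\<A>: "\<phi> \<in> fst ` \<A> \<Longrightarrow> continuous_map X euclideanreal \<phi>"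
      "\<psi> \<in> snd ` \<A> \<Longrightarrow> continuous_map Y euclideanreal \<psi>" for \<phi> \<psi>
    using cont\<P> by (force simp: \<A>_def)+
  obtain Z :: "real topology" and p where
    Z: "tychonoff_space Z" "second_countable Z" "continuous_map X Z p" "open_map X Z p"
       "p ` topspace X = topspace Z"
    and p: "\<forall>\<phi> \<in> fst ` \<A>. \<forall>x \<in> topspace X. \<forall>x' \<in> topspace X. p x = p x' \<longrightarrow> \<phi> x = \<phi> x'"
    using openly_factorizable_countable_family [OF X(2), of "fst ` \<A>"] \<A> cont\<A>(1)
    by blast
  obtain Z' :: "real topology" and q where
    Z': "tychonoff_space Z'" "second_countable Z'" "continuous_map Y Z' q" "open_map Y Z' q"
       "q ` topspace Y = topspace Z'"
    and q: "\<forall>\<psi> \<in> snd ` \<A>. \<forall>y \<in> topspace Y. \<forall>y' \<in> topspace Y. q y = q y' \<longrightarrow> \<psi> y = \<psi> y'"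
    using openly_factorizable_countable_family [OF Y(2), of "snd ` \<A>"] \<A> cont\<A>(2)
    by blast
  define r where "r = (\<lambda>(x,y). (p x, q y))"
  have r: "continuous_map ?XY (prod_topology Z Z') r" "open_map ?XY (prod_topology Z Z') r"
    using Z Z' by (auto simp: r_def continuous_map_prod_top open_map_prod)
  have "r ` topspace ?XY = topspace (prod_topology Z Z')"
    by (simp add: r_def image_paired_Times Z(5) Z'(5))
  with r have quot: "quotient_map ?XY (prod_topology Z Z') r"
    by (intro continuous_open_imp_quotient_map)
  \<comment> \<open>If \<open>f u \<noteq> f u'\<close>, shrink twice around \<open>f u\<close>: first to \<open>W\<close>, whose closure avoids \<open>f u'\<close>, then to
    \<open>V\<close>, whose closure is inside \<open>W\<close>.  Saturation brings \<open>f u'\<close> into the closure of \<open>W\<close>.\<close>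
  have f_eq: "f u = f u'" if u: "u \<in> topspace ?XY" "u' \<in> topspace ?XY" "r u = r u'" for u u'
  proof (rule ccontr)
    assume neq: "f u \<noteq> f u'"
    have fM: "f u \<in> topspace M" "f u' \<in> topspace M"
      using f u by (auto simp: continuous_map_def)
    have reg: "regular_space M"
      using M(1) by (simp add: tychonoff_space_def completely_regular_imp_regular_space)
    obtain N N' where N: "openin M N" "openin M N'" "f u \<in> N" "f u' \<in> N'" "disjnt N N'"
      using M(1) fM neq unfolding tychonoff_space_def Hausdorff_space_def by metis
    obtain C where C: "openin M C" "f u \<in> C" "M closure_of C \<subseteq> N"
      using regular_space_shrink_neighbourhood [OF reg N(1,3)] by blast
    obtain W where W: "W \<in> \<B>" "f u \<in> W" "W \<subseteq> C"
      using base C by meson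
    obtain D where D: "openin M D" "f u \<in> D" "M closure_of D \<subseteq> W"
      using regular_space_shrink_neighbourhood [OF reg op\<B> [OF W(1)] W(2)] by blast
    obtain V where V: "V \<in> \<B>" "f u \<in> V" "V \<subseteq> D"
      using base D by meson
    have i: "(V, W) \<in> \<I>"
      using V W D closure_of_mono [OF V(3), of M] by (auto simp: \<I>_def)
    let ?S = "?R (\<P> (V, W))"
    have "u \<in> ?XY closure_of ?S"
      using \<P>V [OF i] V(2) u(1) by auto
    \<comment> \<open>Each rectangle of \<open>S\<close> is saturated, because \<open>p\<close> and \<open>q\<close> determine the values of its two
      defining functions.\<close>
    moreover have "v' \<in> ?S" if v: "v \<in> ?S" "v' \<in> topspace ?XY" "r v = r v'" for v v'
    proof -
      obtain x y x' y' where v_eq: "v = (x, y)" "v' = (x', y')"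
        by (cases v, cases v') blast
      obtain \<phi> \<psi> where \<phi>\<psi>: "(\<phi>,\<psi>) \<in> \<P> (V, W)" "x \<in> cozero X \<phi>" "y \<in> cozero Y \<psi>"
        using v(1) v_eq(1) by auto
      then have "(\<phi>,\<psi>) \<in> \<A>" using i by (auto simp: \<A>_def)
      then have "\<phi> \<in> fst ` \<A>" "\<psi> \<in> snd ` \<A>" by force+
      moreover have "x \<in> topspace X" "y \<in> topspace Y" "x' \<in> topspace X" "y' \<in> topspace Y"
        using \<phi>\<psi>(2,3) v(2) v_eq(2) by (simp_all add: cozero_def)
      moreover have "p x = p x'" "q y = q y'"
        using v(3) by (simp_all add: v_eq r_def)
      ultimately have "\<phi> x = \<phi> x'" "\<psi> y = \<psi> y'"
        using p q by blast+
      then have "v' \<in> cozero X \<phi> \<times> cozero Y \<psi>"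
        using \<phi>\<psi>(2,3) \<open>x' \<in> topspace X\<close> \<open>y' \<in> topspace Y\<close> by (simp add: v_eq cozero_def)
      with \<phi>\<psi>(1) show ?thesis by auto
    qed
    ultimately have "u' \<in> ?XY closure_of ?S"
      by (rule open_map_closure_of_saturated [OF r _ _ u(2,3), rotated])
    moreover have "f ` (?XY closure_of ?S) \<subseteq> M closure_of (f ` ?S)"
      using f by (rule continuous_map_image_closure_subset)
    moreover have "f ` ?S \<subseteq> C"
      using \<P>W [OF i] W(3) by auto
    ultimately have "f u' \<in> M closure_of C"
      by (meson closure_of_mono image_subset_iff subsetD)
    with C(3) N(4,5) show False
      by (auto simp: disjnt_iff)
  qed
  obtain g where g: "continuous_map (prod_topology Z Z') M g"
      "\<And>u. u \<in> topspace ?XY \<Longrightarrow> g (r u) = f u"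
    by (rule quotient_map_lift_exists [OF quot f]) (use f_eq in blast)+
  from g(2) have "\<forall>x \<in> topspace X. \<forall>y \<in> topspace Y. f (x, y) = g (p x, q y)"
    by (force simp: r_def)
  with Z Z' g(1) show ?thesis by blast
qed

section \<open>Real completeness of Lindelof Tychonoff spaces\<close>

lemma embedding_imp_continuous_map:
  assumes "embedding_map X Y e"
  shows "continuous_map X Y e"
  using assms unfolding embedding_map_def
  by (auto dest!: homeomorphic_imp_continuous_map simp: continuous_map_in_subtopology)

text \<open>
  A Hewitt completion of a Lindelof space adds no points.  If \<open>z\<close> were a new point, countably many
  functions vanishing at \<open>z\<close> would have no common zero in \<open>X\<close>.  As a map \<open>\<Phi>\<close> into the metric space
  of real sequences, they yield the function \<open>d = dist \<Phi> 0\<close>, which vanishes at \<open>z\<close> but nowhere on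
  \<open>X\<close>.  Then \<open>1 / d\<close> is continuous on \<open>X\<close> and extends to some \<open>k\<close>; by density \<open>d * k = 1\<close> everywhere,
  also at \<open>z\<close>, which is absurd.
\<close>

lemma Lindelof_tychonoff_imp_real_complete:
  fixes X :: "'a topology"
  assumes X: "tychonoff_space X" "Lindelof_space X"
  shows "real_complete_space X"
proof -
  obtain H :: "(('a \<Rightarrow> real) \<Rightarrow> real) topology" and e where H: "hewitt_completion X H e"
    using hewitt_completion_exists [OF X(1)] by blast
  then have rc: "real_complete_space H" and emb: "embedding_map X H e"
    and dense: "H closure_of (e ` topspace X) = topspace H"
    unfolding hewitt_completion_def by blast+
  have contE: "continuous_map X H e"
    using emb by (rule embedding_imp_continuous_map)
  from rc obtain I :: "((('a \<Rightarrow> real) \<Rightarrow> real) \<Rightarrow> real) set" and S h where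
    h: "continuous_map H (product_topology (\<lambda>_. euclideanreal) I) h" and inj: "inj_on h (topspace H)"
    unfolding real_complete_space_def homeomorphic_space_def homeomorphic_maps_def
    by (metis continuous_map_in_subtopology inj_on_def)
  have "z \<in> e ` topspace X" if z: "z \<in> topspace H" for z
  proof (rule ccontr)
    assume nz: "z \<notin> e ` topspace X"
    \<comment> \<open>The coordinates of the embedding \<open>h\<close> of \<open>H\<close> into a power of the line, shifted to vanish at \<open>z\<close>.\<close>
    define \<phi> where "\<phi> i w = h w i - h z i" for i w
    have cont\<phi>: "continuous_map H euclideanreal (\<phi> i)" if "i \<in> I" for i
      using h that unfolding \<phi>_def
      by (intro continuous_map_diff) (auto simp: continuous_map_componentwise)
    let ?c = "\<lambda>i. cozero X (\<phi> i \<circ> e)"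
    have op: "openin X U" if "U \<in> ?c ` I" for U
      using that by (auto intro: openin_cozero continuous_map_compose [OF contE] cont\<phi>)
    have "topspace X \<subseteq> \<Union>(?c ` I)"
    proof
      fix x assume x: "x \<in> topspace X"
      have ex: "e x \<in> topspace H" using contE x by (auto simp: continuous_map_def)
      with z nz x have "h (e x) \<noteq> h z" using inj by (metis image_eqI inj_on_def)
      moreover have "h (e x) \<in> extensional I" "h z \<in> extensional I"
        using h ex z by (auto simp: continuous_map_def PiE_def Pi_iff)
      ultimately obtain i where "i \<in> I" "h (e x) i \<noteq> h z i"
        by (meson extensionalityI)
      with x show "x \<in> \<Union>(?c ` I)" by (auto simp: cozero_def \<phi>_def)
    qed
    then have cover: "\<Union>(?c ` I) = topspace X" by (auto simp: cozero_def)
    obtain \<V> where "countable \<V> \<and> \<V> \<subseteq> ?c ` I" and \<V>: "\<Union>\<V> = topspace X"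
      using Lindelof_spaceD [OF X(2) op cover] by metis
    then obtain J where J: "countable J" "J \<subseteq> I" "\<V> = ?c ` J"
      unfolding countable_subset_image by blast
    have "J \<noteq> {}"
    proof
      assume "J = {}"
      with J \<V> have "topspace X = {}" by auto
      with dense z show False by auto
    qed
    define s where "s = from_nat_into J"
    have s: "range s = J"
      unfolding s_def using \<open>J \<noteq> {}\<close> J(1) by (rule range_from_nat_into)
    define d where "d w = dist (\<lambda>n. \<phi> (s n) w) (\<lambda>n. 0)" for w
    have seq: "continuous_map H (euclidean :: (nat \<Rightarrow> real) topology) (\<lambda>w n. \<phi> (s n) w)"
      using cont\<phi> s J(2)
      by (auto simp: continuous_map_componentwise_UNIV simp flip: euclidean_product_topology)
    have "continuous_map euclidean euclideanreal (\<lambda>v :: nat \<Rightarrow> real. dist v (\<lambda>n. 0))"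
      by (simp add: continuous_on_dist)
    from continuous_map_compose [OF seq this] have d: "continuous_map H euclideanreal d"
      by (simp add: d_def [abs_def] o_def)
    have dnz: "d (e x) \<noteq> 0" if x: "x \<in> topspace X" for x
    proof -
      obtain j where j: "j \<in> J" "\<phi> j (e x) \<noteq> 0"
        using x \<V> J(3) by (auto simp: cozero_def)
      then have "j \<in> range s" by (simp add: s)
      then obtain n where "j = s n" ..
      with j(2) show ?thesis
        by (auto simp: d_def fun_eq_iff)
    qed
    have "continuous_map X euclideanreal (\<lambda>x. inverse (d (e x)))"
      using continuous_map_compose [OF contE d] dnz
      by (intro continuous_map_real_inverse) (auto simp: o_def)
    from hewitt_completion_extension_any_type [OF H real_complete_space_real_line_copy
        [OF homeomorphic_space_refl] this]
    obtain k where k: "continuous_map H euclideanreal k"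
        "\<forall>x \<in> topspace X. k (e x) = inverse (d (e x))"
      by metis
    have "d z * k z = 1"
    proof (rule forall_in_closure_of_eq [where f = "\<lambda>w. d w * k w" and g = "\<lambda>_. 1"])
      show "z \<in> H closure_of (e ` topspace X)" using dense z by simp
      show "continuous_map H euclideanreal (\<lambda>w. d w * k w)"
        using d k(1) by (rule continuous_map_real_mult)
    qed (use k(2) dnz in auto)
    moreover have "d z = 0" by (simp add: d_def \<phi>_def)
    ultimately show False by simp
  qed
  then have "e ` topspace X = topspace H"
    using continuous_map_image_subset_topspace [OF contE] by auto
  with emb have XH: "X homeomorphic_space H"
    unfolding embedding_map_def
    by (simp add: homeomorphic_map_imp_homeomorphic_space)
  obtain I :: "((('a \<Rightarrow> real) \<Rightarrow> real) \<Rightarrow> real) set" and S where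
    S: "closedin (product_topology (\<lambda>_. euclideanreal) I) S"
    and "H homeomorphic_space subtopology (product_topology (\<lambda>_. euclideanreal) I) S"
    using rc unfolding real_complete_space_def by auto
  then show ?thesis
    using real_complete_space_any_index [OF S] homeomorphic_space_trans [OF XH] by auto
qed

section \<open>Openly factorizable products and their Hewitt completions\<close>

theorem theorem3p3:
  fixes X :: "'a topology" and Y :: "'b topology"
  assumes "tychonoff_space X" and "tychonoff_space Y"
    and "openly_factorizable X" and "openly_factorizable Y"
    and "weakly_Lindelof_space (prod_topology X Y)"
  shows "openly_factorizable (prod_topology X Y) \<and>
    (\<forall>(Z :: 'c topology) f
       (HX :: 'hx topology) eX (HY :: 'hy topology) eY (HZ :: 'hz topology) eZ.
       tychonoff_space Z \<and> continuous_map (prod_topology X Y) Z f \<and>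
       hewitt_completion X HX eX \<and> hewitt_completion Y HY eY \<and> hewitt_completion Z HZ eZ \<longrightarrow>
       (\<exists>fbar. continuous_map (prod_topology HX HY) HZ fbar \<and>
          (\<forall>x \<in> topspace X. \<forall>y \<in> topspace Y. fbar (eX x, eY y) = eZ (f (x, y)))))"
proof -
  have cr: "completely_regular_space X" "completely_regular_space Y"
    using assms(1,2) by (auto simp: tychonoff_space_def)
  note factor = factorizes_through_product_of_open_maps [OF cr(1) assms(3) cr(2) assms(4,5)]
  have "openly_factorizable (prod_topology X Y)"
  proof (rule openly_factorizable_if_any_type)
    fix M :: "real topology" and f
    assume "tychonoff_space M" "second_countable M" "continuous_map (prod_topology X Y) M f"
    then obtain Z Z' :: "real topology" and p q g where
      Z: "tychonoff_space Z" "second_countable Z" "continuous_map X Z p" "open_map X Z p"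
         "p ` topspace X = topspace Z"
      and Z': "tychonoff_space Z'" "second_countable Z'" "continuous_map Y Z' q" "open_map Y Z' q"
         "q ` topspace Y = topspace Z'"
      and g: "continuous_map (prod_topology Z Z') M g"
         "\<forall>x \<in> topspace X. \<forall>y \<in> topspace Y. f (x, y) = g (p x, q y)"
      using factor by metis
    let ?r = "\<lambda>(x, y). (p x, q y)"
    have "tychonoff_space (prod_topology Z Z')"
      using Z(1) Z'(1)
      by (simp add: tychonoff_space_def completely_regular_space_prod_topology
          Hausdorff_space_prod_topology)
    moreover have "second_countable (prod_topology Z Z')"
      using Z(2) Z'(2) by (rule second_countable_prod_topology)
    moreover have "continuous_map (prod_topology X Y) (prod_topology Z Z') ?r"
      using Z(3) Z'(3) by (simp add: continuous_map_prod_top)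
    moreover have "open_map (prod_topology X Y) (prod_topology Z Z') ?r"
      using Z(4) Z'(4) by (rule open_map_prod)
    moreover have "?r ` topspace (prod_topology X Y) = topspace (prod_topology Z Z')"
      by (simp add: image_paired_Times Z(5) Z'(5))
    moreover have "\<forall>u \<in> topspace (prod_topology X Y). f u = g (?r u)"
      using g(2) by auto
    ultimately show "\<exists>(W :: (real \<times> real) topology) r g.
          tychonoff_space W \<and> second_countable W \<and>
          continuous_map (prod_topology X Y) W r \<and> open_map (prod_topology X Y) W r \<and>
          r ` topspace (prod_topology X Y) = topspace W \<and>
          continuous_map W M g \<and> (\<forall>u \<in> topspace (prod_topology X Y). f u = g (r u))"
      using g(1) by blast
  qed
  moreover have "\<exists>fbar. continuous_map (prod_topology HX HY) HZ fbar \<and>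
          (\<forall>x \<in> topspace X. \<forall>y \<in> topspace Y. fbar (eX x, eY y) = eZ (f (x, y)))"
    if f: "continuous_map (prod_topology X Y) Z f"
      and H: "hewitt_completion X HX eX" "hewitt_completion Y HY eY" "hewitt_completion Z HZ eZ"
    for Z :: "'c topology" and f and HX :: "'hx topology" and eX
      and HY :: "'hy topology" and eY and HZ :: "'hz topology" and eZ
  proof -
    let ?e = "\<lambda>(x, y). (eX x, eY y)"
    \<comment> \<open>The product of the Hewitt completions contains \<open>X \<times> Y\<close> densely, so that maps into the real
      complete space \<open>HZ\<close> extend as soon as all real functions do.\<close>
    have "\<exists>g. continuous_map (prod_topology HX HY) HZ g \<and>
        (\<forall>u \<in> topspace (prod_topology X Y). g (?e u) = (eZ \<circ> f) u)"
    proof (rule extends_to_real_complete)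
      have "?e ` topspace (prod_topology X Y) = eX ` topspace X \<times> eY ` topspace Y"
        by (simp add: image_paired_Times)
      then show "prod_topology HX HY closure_of (?e ` topspace (prod_topology X Y))
          = topspace (prod_topology HX HY)"
        using H(1,2) by (simp add: closure_of_Times hewitt_completion_def)
      show "real_complete_space HZ"
        using H(3) by (simp add: hewitt_completion_def)
      have "continuous_map Z HZ eZ"
        using H(3) by (simp add: hewitt_completion_def embedding_imp_continuous_map)
      with f show "continuous_map (prod_topology X Y) HZ (eZ \<circ> f)"
        by (rule continuous_map_compose)
    next
      fix \<phi> assume \<phi>: "continuous_map (prod_topology X Y) euclideanreal \<phi>"
      obtain V V' :: "real topology" and p q g where
        V: "tychonoff_space V" "second_countable V" "continuous_map X V p"
        and V': "tychonoff_space V'" "second_countable V'" "continuous_map Y V' q"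
        and g: "continuous_map (prod_topology V V') euclideanreal g"
           "\<forall>x \<in> topspace X. \<forall>y \<in> topspace Y. \<phi> (x, y) = g (p x, q y)"
        using factor [OF tychonoff_euclidean second_countable_euclidean \<phi>] by metis
      have "real_complete_space V" "real_complete_space V'"
        using V V' by (auto intro: Lindelof_tychonoff_imp_real_complete
            second_countable_imp_Lindelof_space)
      then obtain P Q where
        P: "continuous_map HX V P" "\<forall>x \<in> topspace X. P (eX x) = p x" and
        Q: "continuous_map HY V' Q" "\<forall>y \<in> topspace Y. Q (eY y) = q y"
        using hewitt_completion_extension_any_type [OF H(1) _ V(3)]
          hewitt_completion_extension_any_type [OF H(2) _ V'(3)] by metis
      have "continuous_map (prod_topology HX HY) (prod_topology V V') (\<lambda>(z, w). (P z, Q w))"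
        using P(1) Q(1) by (simp add: continuous_map_prod_top)
      then have "continuous_map (prod_topology HX HY) euclideanreal (g \<circ> (\<lambda>(z, w). (P z, Q w)))"
        using g(1) by (rule continuous_map_compose)
      moreover have "\<forall>u \<in> topspace (prod_topology X Y). (g \<circ> (\<lambda>(z, w). (P z, Q w))) (?e u) = \<phi> u"
        using P(2) Q(2) g(2) by auto
      ultimately show "\<exists>g. continuous_map (prod_topology HX HY) euclideanreal g \<and>
          (\<forall>u \<in> topspace (prod_topology X Y). g (?e u) = \<phi> u)" by blast
    qed
    then show ?thesis by (fastforce simp: o_def)
  qed
  ultimately show ?thesis by blast
qed

end
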